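(* Let $(\mathcal X,\mathcal X^\Omega)$ be a countably separated quasi-universal space. Then $$\mathcal B(\mathcal X^\Omega)=(\mathcal E)_{\mathsf P(\mathcal X,\mathcal X^\Omega)}$$ for every countable subset $\mathcal E\subseteq\mathcal B(\mathcal X^\Omega)$ that separates the points of $\mathcal X$, where $\mathsf P(\mathcal X,\mathcal X^\Omega)$ is the set of all push-forward probability measures $X_*P:\mathcal B(\mathcal X^\Omega)\to[0,1]$ with $X\in\mathcal X^\Omega$ and $P$ a probability measure on $(\Omega,\mathcal B_\Omega)$.
   Context: Fix the sample space: $\Omega=[0,1]^{\mathbb N}$, $\mathcal B_\Omega$ the $\sigma$-algebra of all universally measurable subsets of $\Omega$ (the universal completion of the Borel $\sigma$-algebra), $\Omega^\Omega$ the set of all measurable maps $(\Omega,\mathcal B_\Omega)\to(\Omega,\mathcal B_\Omega)$. A quasi-universal space is a pair $(\mathcal X,\mathcal X^\Omega)$ of a set $\mathcal X$ and a set $\mathcal X^\Omega$ of maps $\Omega\to\mathcal X$ containing all constant maps and closed under $X\mapsto X\circ\Phi$, $\Phi\in\Omega^\Omega$. Its induced $\sigma$-algebra is $\mathcal B(\mathcal X^\Omega)=\{A\subseteq\mathcal X\mid X^{-1}(A)\in\mathcal B_\Omega\ \forall X\in\mathcal X^\Omega\}$. It is countably separated if some countable subset of $\mathcal B(\mathcal X^\Omega)$ separates the points of $\mathcal X$ (for $x_1\ne x_2$ there is a member containing exactly one of them). For a set $\mathcal Q$ of probability measures on $\mathcal B(\mathcal X^\Omega)$, $(\mathcal E)_{\mathcal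 Q}:=\bigcap_{Q\in\mathcal Q}(\sigma(\mathcal E))_{Q}$ is the intersection of the Lebesgue completions of $\sigma(\mathcal E)$ with respect to the restrictions $Q|_{\sigma(\mathcal E)}$; for $\mathcal Q=\emptyset$ it is the power set of $\mathcal X$. *)

theory Defs
  imports "HOL-Probability.Probability"
begin

definition Omega :: "(nat \<Rightarrow> real) set" where
  "Omega = {\<omega>. \<forall>n. \<omega> n \<in> {0..1}}"

definition universally_measurable_sets :: "'a measure \<Rightarrow> 'a set set" where
  "universally_measurable_sets M =
     {A. A \<subseteq> space M \<and>
         (\<forall>\<mu>. prob_space \<mu> \<longrightarrow> sets \<mu> = sets M \<longrightarrow> A \<in> sets (completion \<mu>))}"

lemma sigma_algebra_universally_measurable_sets:
  "sigma_algebra (space M) (universally_measurable_sets M)"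
proof -
  have *: "A \<in> sets (completion \<mu>) \<Longrightarrow> space M - A \<in> sets (completion \<mu>)"
    if "sets \<mu> = sets M" for A \<mu>
    using sets.compl_sets[of A "completion \<mu>"] sets_eq_imp_space_eq[OF that] by simp
  show ?thesis
    unfolding sigma_algebra_iff2 universally_measurable_sets_def
    by (auto intro!: * sets.countable_UN)
qed

text \<open>The topology underlying \<open>borel\<close> below is the product topology on \<^typ>\<open>nat \<Rightarrow> real\<close>, so
  \<open>restrict_space borel Omega\<close> is the Borel \<open>\<sigma>\<close>-algebra of the Hilbert cube. The measure
  component of \<open>B_Omega\<close> and of \<open>induced_algebra\<close> is irrelevant: both are used only as
  measurable spaces.\<close>

definition B_Omega :: "(nat \<Rightarrow> real) measure" where
  "B_Omega = sigma Omega (universally_measurable_sets (restrict_space borel Omega))"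

lemma space_B_Omega: "space B_Omega = Omega"
  and sets_B_Omega: "sets B_Omega = universally_measurable_sets (restrict_space borel Omega)"
proof -
  have "sigma_algebra Omega (universally_measurable_sets (restrict_space borel Omega))"
    using sigma_algebra_universally_measurable_sets[of "restrict_space borel Omega"]
    by (simp add: space_restrict_space)
  then show "space B_Omega = Omega"
    "sets B_Omega = universally_measurable_sets (restrict_space borel Omega)"
    unfolding B_Omega_def
    by (simp_all add: sigma_algebra.sets_measure_of_eq sigma_algebra.space_measure_of_eq)
qed

text \<open>Maps out of \<open>Omega\<close> are represented by functions that are \<open>undefined\<close> outside \<open>Omega\<close>;
  \<open>compose Omega f \<Phi>\<close> is \<open>f \<circ> \<Phi>\<close> restricted in this way.\<close>

locale quasi_universal_space =
  fixes X :: "'a set" and XO :: "((nat \<Rightarrow> real) \<Rightarrow> 'a) set"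
  assumes maps: "XO \<subseteq> Omega \<rightarrow>\<^sub>E X"
    and const: "x \<in> X \<Longrightarrow> (\<lambda>\<omega>\<in>Omega. x) \<in> XO"
    and comp: "f \<in> XO \<Longrightarrow> \<Phi> \<in> B_Omega \<rightarrow>\<^sub>M B_Omega \<Longrightarrow> compose Omega f \<Phi> \<in> XO"

definition induced_sets :: "'a set \<Rightarrow> ((nat \<Rightarrow> real) \<Rightarrow> 'a) set \<Rightarrow> 'a set set" where
  "induced_sets X XO = {A. A \<subseteq> X \<and> (\<forall>f\<in>XO. f -` A \<inter> Omega \<in> sets B_Omega)}"

definition induced_algebra :: "'a set \<Rightarrow> ((nat \<Rightarrow> real) \<Rightarrow> 'a) set \<Rightarrow> 'a measure" where
  "induced_algebra X XO = sigma X (induced_sets X XO)"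

lemma (in quasi_universal_space)
  shows space_induced_algebra: "space (induced_algebra X XO) = X"
    and sets_induced_algebra: "sets (induced_algebra X XO) = induced_sets X XO"
proof -
  have *: "f -` (X - A) \<inter> Omega = space B_Omega - f -` A \<inter> Omega" if "f \<in> XO" for f A
    using that maps by (auto simp: space_B_Omega)
  have **: "f -` (\<Union>i. A i) \<inter> Omega = (\<Union>i. f -` A i \<inter> Omega)" for f and A :: "nat \<Rightarrow> 'a set"
    by auto
  have "sigma_algebra X (induced_sets X XO)"
    unfolding sigma_algebra_iff2 induced_sets_def
    by (auto simp: * ** simp del: vimage_Diff vimage_UN UN_simps intro!: sets.countable_UN)
  then show "space (induced_algebra X XO) = X"
    "sets (induced_algebra X XO) = induced_sets X XO"
    unfolding induced_algebra_def
    by (simp_all add: sigma_algebra.sets_measure_of_eq sigma_algebra.space_measure_of_eq)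
qed

definition separates_points :: "'a set set \<Rightarrow> 'a set \<Rightarrow> bool" where
  "separates_points \<E> X \<longleftrightarrow>
     (\<forall>x\<in>X. \<forall>y\<in>X. x \<noteq> y \<longrightarrow> (\<exists>A\<in>\<E>. (x \<in> A) \<noteq> (y \<in> A)))"

definition countably_separated :: "'a set \<Rightarrow> 'a set set \<Rightarrow> bool" where
  "countably_separated X \<A> \<longleftrightarrow>
     (\<exists>\<E>. \<E> \<subseteq> \<A> \<and> countable \<E> \<and> separates_points \<E> X)"

definition push_forward_measures ::
    "'a set \<Rightarrow> ((nat \<Rightarrow> real) \<Rightarrow> 'a) set \<Rightarrow> 'a measure set" where
  "push_forward_measures X XO =
     {distr P (induced_algebra X XO) f | f P. f \<in> XO \<and> prob_space P \<and> sets P = sets B_Omega}"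

text \<open>Intersecting with \<^term>\<open>Pow X\<close> only matters for \<open>\<Q> = {}\<close>, where the result is the
  power set of \<open>X\<close>.\<close>

definition completed_sets :: "'a set \<Rightarrow> 'a set set \<Rightarrow> 'a measure set \<Rightarrow> 'a set set" where
  "completed_sets X \<E> \<Q> =
     Pow X \<inter> (\<Inter>Q\<in>\<Q>. sets (completion (restr_to_subalg Q (sigma X \<E>))))"

end

(* For A in the induced algebra and X in XO, Lusin's theorem exhausts the preimage of A by compact
   sets K on which all indicators of X^-1(E), E in \<E>, are continuous. The map
   h = (indicator E)_E is injective on the space and h \<circ> X is continuous on K, so
   X(K) = h^-1((h \<circ> X)(K)) is the preimage of a compact set and lies in \<sigma>(\<E>). Hence A, and likewise
   its complement, is exhausted from inside by \<sigma>(\<E>), that is, A lies in the completion. Compactness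
   takes the place of the theory of analytic sets here. The converse inclusion pulls the sandwich
   E0 \<subseteq> A \<subseteq> E1 with Q(E1 - E0) = 0 back to Omega. *)
theory Submission
  imports Defs
begin

section \<open>Compact inner regularity of probability measures on \<open>B_Omega\<close>\<close>

text \<open>\<open>Omega\<close> is an intersection of closed coordinate conditions. Closedness
  identifies the Borel sets of the subspace \<open>Omega\<close> with the Borel sets of
  \<open>nat \<Rightarrow> real\<close> contained in it.\<close>

lemma closed_Omega: "closed Omega"
proof -
  have "closed {\<omega> :: nat \<Rightarrow> real. \<omega> n \<in> {0..1}}" for n
    unfolding atLeastAtMost_iff
    by (intro closed_Collect_conj closed_Collect_le continuous_on_product_coordinates
        continuous_on_const)
  then have "closed (\<Inter>n. {\<omega> :: nat \<Rightarrow> real. \<omega> n \<in> {0..1}})"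
    by (intro closed_INT) auto
  also have "(\<Inter>n. {\<omega> :: nat \<Rightarrow> real. \<omega> n \<in> {0..1}}) = Omega"
    by (auto simp: Omega_def)
  finally show ?thesis .
qed

lemma borel_imp_B_Omega:
  assumes "A \<in> sets borel" "A \<subseteq> Omega"
  shows "A \<in> sets B_Omega"
proof -
  have "A \<in> sets (restrict_space borel Omega)"
    using assms closed_Omega by (auto simp: sets_restrict_space)
  then show ?thesis
    using assms(2)
    by (auto simp: sets_B_Omega universally_measurable_sets_def space_restrict_space)
qed

lemma measurable_restrict_borel_B_Omega:
  assumes "sets P = sets B_Omega"
  shows "(\<lambda>x. x) \<in> P \<rightarrow>\<^sub>M restrict_space borel Omega"
proof (rule measurableI)
  have sp: "space P = Omega"
    using sets_eq_imp_space_eq[OF assms] by (simp add: space_B_Omega)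
  show "x \<in> space P \<Longrightarrow> x \<in> space (restrict_space borel Omega)" for x
    by (simp add: sp space_restrict_space)
  show "(\<lambda>x. x) -` A \<inter> space P \<in> sets P" if "A \<in> sets (restrict_space borel Omega)" for A
  proof -
    have "A \<in> sets borel" "A \<subseteq> Omega"
      using that closed_Omega by (auto simp: sets_restrict_space)
    then show ?thesis
      using borel_imp_B_Omega by (simp add: sp assms Int_absorb2)
  qed
qed

text \<open>Restricting \<open>P\<close> to Borel sets gives a measure \<open>?D\<close> whose
  completion contains the universally measurable set \<open>S\<close>. The Borel part of
  \<open>S\<close> in this completion is \<open>T\<close>. The remainder lies in a Borel set that is
  null for \<open>?D\<close>, hence for \<open>P\<close>, because both measures agree on Borel
  subsets of \<open>Omega\<close>.\<close>

lemma B_Omega_borel_inner: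
  assumes "prob_space P" "sets P = sets B_Omega" "S \<in> sets B_Omega"
  obtains T where "T \<in> sets borel" "T \<subseteq> S" "emeasure P T = emeasure P S"
proof -
  let ?R = "restrict_space borel Omega :: (nat \<Rightarrow> real) measure"
  let ?D = "distr P ?R (\<lambda>x. x)"
  note id = measurable_restrict_borel_B_Omega[OF assms(2)]
  have sp: "space P = Omega"
    using sets_eq_imp_space_eq[OF assms(2)] by (simp add: space_B_Omega)
  have "prob_space ?D"
    using assms(1) id by (rule prob_space.prob_space_distr)
  then have "S \<in> sets (completion ?D)"
    using assms(3) by (auto simp: sets_B_Omega universally_measurable_sets_def)
  then obtain T N N' where T: "S = T \<union> N" "N \<subseteq> N'" "N' \<in> null_sets ?D" "T \<in> sets ?D"
    by (rule sets_completionE)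
  have TR: "T \<in> sets borel" "T \<subseteq> Omega"
    using T(4) closed_Omega by (auto simp: sets_restrict_space)
  have "N' \<in> sets borel" "N' \<subseteq> Omega"
    using T(3) closed_Omega by (auto simp: null_sets_def sets_restrict_space)
  moreover have "emeasure P N' = 0"
    using T(3) id \<open>N' \<subseteq> Omega\<close>
    by (auto simp: null_sets_def emeasure_distr sp Int_absorb2)
  ultimately have N': "N' \<in> null_sets P"
    using borel_imp_B_Omega assms(2) by (auto simp: null_sets_def)
  have "T \<subseteq> S"
    unfolding T(1) by blast
  have TP: "T \<in> sets P"
    using TR borel_imp_B_Omega assms(2) by auto
  have "emeasure P S \<le> emeasure P (T \<union> N')"
  proof (rule emeasure_mono)
    show "S \<subseteq> T \<union> N'"
      unfolding T(1) using T(2) by blast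
    show "T \<union> N' \<in> sets P"
      using TP N' by (intro sets.Un) auto
  qed
  also have "\<dots> = emeasure P T"
    using TP N' by (rule emeasure_Un_null_set)
  finally have "emeasure P T = emeasure P S"
    using emeasure_mono[of T S P] \<open>T \<subseteq> S\<close> assms(2,3) by (intro antisym) auto
  then show thesis
    using that TR(1) \<open>T \<subseteq> S\<close> by blast
qed

text \<open>A Borel subset \<open>T\<close> of \<open>S\<close> with the same measure reduces the
  claim to the inner regularity of finite Borel measures on Polish spaces.\<close>

lemma B_Omega_inner_regular:
  assumes P: "prob_space P" "sets P = sets B_Omega" and S: "S \<in> sets B_Omega" and e: "0 < e"
  obtains K where "compact K" "K \<subseteq> S" "measure P (S - K) < e"
proof -
  interpret prob_space P by (rule P(1))
  have sp: "space P = Omega"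
    using sets_eq_imp_space_eq[OF P(2)] by (simp add: space_B_Omega)
  obtain T where T: "T \<in> sets borel" "T \<subseteq> S" "emeasure P T = emeasure P S"
    using B_Omega_borel_inner[OF P S] .
  \<comment> \<open>The target is now the whole Polish space \<open>nat \<Rightarrow> real\<close>,
    the setting of \<open>inner_regular\<close>; the mass still sits on
    \<open>Omega\<close>.\<close>
  let ?D = "distr P borel (\<lambda>x. x)"
  have id: "(\<lambda>x. x) \<in> P \<rightarrow>\<^sub>M borel"
    using measurable_restrict_borel_B_Omega[OF P(2)] by (simp add: measurable_restrict_space2_iff)
  interpret D: prob_space ?D
    using id by (rule prob_space_distr)
  have SO: "S \<subseteq> Omega"
    using sets.sets_into_space[OF S] by (simp add: space_B_Omega)
  have D_eq: "emeasure ?D A = emeasure P A" if "A \<in> sets borel" "A \<subseteq> Omega" for A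
    using that id by (simp add: emeasure_distr sp Int_absorb2)
  have "emeasure P S = emeasure ?D T"
    using T SO D_eq by auto
  also have "\<dots> = (SUP K \<in> {K. K \<subseteq> T \<and> compact K}. emeasure ?D K)"
    by (rule inner_regular) (simp_all add: T D.emeasure_eq_measure)
  finally have SUP: "emeasure P S = (SUP K \<in> {K. K \<subseteq> T \<and> compact K}. emeasure ?D K)" .
  have "\<exists>K. K \<subseteq> T \<and> compact K \<and> measure P S - e < measure P K"
  \<comment> \<open>\<open>ennreal\<close> truncates negative reals to 0, so the comparison with the
    supremum is made only for a nonnegative bound. For a negative bound the empty set already
    suffices.\<close>
  proof (cases "measure P S - e < 0")
    case True
    then show ?thesis by (intro exI[of _ "{}"]) simp
  next
    case False
    then have "ennreal (measure P S - e) < (SUP K \<in> {K. K \<subseteq> T \<and> compact K}. emeasure ?D K)"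
      unfolding SUP[symmetric] emeasure_eq_measure using e by (intro ennreal_lessI) auto
    then obtain K where K: "K \<subseteq> T" "compact K" "ennreal (measure P S - e) < emeasure ?D K"
      unfolding less_SUP_iff by auto
    have "emeasure ?D K = emeasure P K"
      using K T SO by (intro D_eq) (auto intro: borel_compact)
    then have "measure P S - e < measure P K"
      using K(3) False by (simp add: emeasure_eq_measure ennreal_less_iff)
    then show ?thesis using K by auto
  qed
  then obtain K where K: "K \<subseteq> T" "compact K" "measure P S - e < measure P K" by auto
  have "measure P (S - K) = measure P S - measure P K"
    using K T SO S P(2) by (intro finite_measure_Diff) (auto intro!: borel_imp_B_Omega borel_compact)
  with K T show thesis
    by (intro that[of K]) auto
qed

section \<open>Lusin's theorem for countably many indicators\<close>

text \<open>The indicator is constantly 1 on \<open>K\<close> and constantly 0 on \<open>L\<close>,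
  and continuity glues over two closed pieces.\<close>

lemma continuous_on_indicator_disjoint_closed:
  assumes "closed K" "closed L" "K \<subseteq> C" "L \<inter> C = {}"
  shows "continuous_on (K \<union> L) (indicator C :: 'a::topological_space \<Rightarrow> real)"
proof (rule continuous_on_closed_Un)
  show "continuous_on K (indicator C :: 'a \<Rightarrow> real)"
    using assms by (intro continuous_on_eq[OF continuous_on_const[of K 1]]) auto
  show "continuous_on L (indicator C :: 'a \<Rightarrow> real)"
    using assms by (intro continuous_on_eq[OF continuous_on_const[of L 0]]) (auto simp: indicator_def)
qed (use assms in auto)

text \<open>Each \<open>C n\<close> and its complement are approximated from inside by compact sets
  \<open>K n\<close> and \<open>L n\<close>. On a set covered by \<open>K n \<union> L n\<close> for
  every \<open>n\<close>, all the indicators are continuous at once.\<close>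

lemma Lusin_B_Omega:
  fixes C :: "nat \<Rightarrow> (nat \<Rightarrow> real) set"
  assumes P: "prob_space P" "sets P = sets B_Omega" and B: "B \<in> sets B_Omega"
    and C: "\<And>n. C n \<in> sets B_Omega" and e: "0 < e"
  obtains K where "compact K" "K \<subseteq> B" "measure P (B - K) < e"
    "\<And>n. continuous_on K (indicator (C n) :: _ \<Rightarrow> real)"
proof -
  interpret prob_space P by (rule P(1))
  have sp: "space P = Omega"
    using sets_eq_imp_space_eq[OF P(2)] by (simp add: space_B_Omega)
  obtain K0 where K0: "compact K0" "K0 \<subseteq> B" "measure P (B - K0) < e / 2"
    using B_Omega_inner_regular[OF P B] e by (metis half_gt_zero)
  \<comment> \<open>The \<open>d n\<close> add up to \<open>e / 4\<close>. Each \<open>n\<close>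
    costs two such errors, one for \<open>K n\<close> and one for \<open>L n\<close>, so together
    they use \<open>e / 2\<close>; the other half is the allowance of \<open>K0\<close>.\<close>
  define d where "d n = e / 4 * (1/2)^Suc n" for n
  have d: "0 < d n" for n
    using e by (simp add: d_def)
  have CO: "Omega - C n \<in> sets B_Omega" for n
    using sets.compl_sets[OF C[of n]] by (simp add: space_B_Omega)
  have "\<forall>n. \<exists>K. compact K \<and> K \<subseteq> C n \<and> measure P (C n - K) < d n"
    using B_Omega_inner_regular[OF P C d] by metis
  then obtain K where K: "\<And>n. compact (K n)" "\<And>n. K n \<subseteq> C n" "\<And>n. measure P (C n - K n) < d n"
    by metis
  have "\<forall>n. \<exists>L. compact L \<and> L \<subseteq> Omega - C n \<and> measure P (Omega - C n - L) < d n"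
    using B_Omega_inner_regular[OF P CO d] by metis
  then obtain L where L: "\<And>n. compact (L n)" "\<And>n. L n \<subseteq> Omega - C n"
      "\<And>n. measure P (Omega - C n - L n) < d n"
    by metis
  have CsubO: "C n \<subseteq> Omega" for n
    using sets.sets_into_space[OF C[of n]] by (simp add: space_B_Omega)
  have BsubO: "B \<subseteq> Omega"
    using sets.sets_into_space[OF B] by (simp add: space_B_Omega)
  have [measurable]: "C n \<in> sets P" "B \<in> sets P" "Omega \<in> sets P" for n
    using C B P(2) sets.top[of P] sp by auto
  have [measurable]: "K n \<in> sets P" "L n \<in> sets P" "K0 \<in> sets P" for n
    using K[of n] L[of n] K0 P(2) CsubO[of n] BsubO by (auto intro!: borel_imp_B_Omega borel_compact)
  define J where "J = K0 \<inter> (\<Inter>n. K n \<union> L n)"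
  \<comment> \<open>\<open>U n\<close> is the part of \<open>Omega\<close> missed by
    \<open>K n \<union> L n\<close>, so a point of \<open>B - J\<close> lies outside
    \<open>K0\<close> or in some \<open>U n\<close>.\<close>
  define U where "U n = (C n - K n) \<union> (Omega - C n - L n)" for n
  have [measurable]: "U n \<in> sets P" for n
    unfolding U_def by measurable
  have U: "measure P (U n) \<le> 2 * d n" for n
  proof -
    have "measure P (U n) \<le> measure P (C n - K n) + measure P (Omega - C n - L n)"
      unfolding U_def by (intro measure_Un_le) auto
    then show ?thesis
      using K(3)[of n] L(3)[of n] by simp
  qed
  have sums: "(\<lambda>n. 2 * d n) sums (e / 2)"
    unfolding d_def using sums_mult[OF power_half_series, of "e/2"] by (simp add: mult.assoc)
  have summable: "summable (\<lambda>n. measure P (U n))"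
    by (rule summable_comparison_test'[OF sums_summable[OF sums], of 0]) (use U in simp)
  have "measure P (\<Union>n. U n) \<le> (\<Sum>n. measure P (U n))"
    using summable by (intro finite_measure_subadditive_countably) auto
  also have "\<dots> \<le> (\<Sum>n. 2 * d n)"
    using U summable sums by (intro suminf_le) (auto simp: sums_iff)
  also have "\<dots> = e / 2"
    using sums by (simp add: sums_iff)
  finally have UU: "measure P (\<Union>n. U n) \<le> e / 2" .
  have "measure P (B - J) \<le> measure P ((B - K0) \<union> (\<Union>n. U n))"
    using BsubO by (intro finite_measure_mono) (auto simp: J_def U_def)
  also have "\<dots> \<le> measure P (B - K0) + measure P (\<Union>n. U n)"
    by (intro measure_Un_le) auto
  \<comment> \<open>Strictness comes from \<open>K0\<close> alone: the union of the
    \<open>U n\<close> is only known to have measure at most \<open>e / 2\<close>.\<close>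
  also have "\<dots> < e"
    using UU K0(3) by simp
  finally have "measure P (B - J) < e" .
  moreover have "compact J"
    unfolding J_def using K(1) L(1) K0(1)
    by (intro compact_Int_closed closed_INT) (auto intro: compact_imp_closed)
  moreover have "continuous_on J (indicator (C n) :: _ \<Rightarrow> real)" for n
  proof (rule continuous_on_subset)
    show "continuous_on (K n \<union> L n) (indicator (C n) :: _ \<Rightarrow> real)"
      using K(1,2)[of n] L(1,2)[of n]
      by (intro continuous_on_indicator_disjoint_closed compact_imp_closed) auto
  qed (auto simp: J_def)
  ultimately show thesis
    using that[of J] K0(2) by (auto simp: J_def)
qed

section \<open>Approximating induced sets from inside by members of the generated
  \<sigma>-algebra\<close>

lemma (in quasi_universal_space) inner_approximation:
  assumes E: "\<E> \<subseteq> induced_sets X XO" "countable \<E>" "separates_points \<E> X"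
    and A: "A \<in> induced_sets X XO" and f: "f \<in> XO"
    and P: "prob_space P" "sets P = sets B_Omega" and e: "0 < e"
  obtains G where "G \<in> sigma_sets X \<E>" "G \<subseteq> A" "measure P (f -` (A - G) \<inter> Omega) < e"
proof -
  have fX: "f \<omega> \<in> X" if "\<omega> \<in> Omega" for \<omega>
    using maps f that by auto
  have EX: "\<E> \<subseteq> Pow X"
    using E(1) by (auto simp: induced_sets_def)
  interpret prob_space P by (rule P(1))
  \<comment> \<open>Inserting the empty set makes the family nonempty, so that
    \<open>from_nat_into\<close> enumerates it exactly even if \<open>\<E>\<close> is empty. The
    added set gives \<open>h\<close> only a zero coordinate.\<close>
  define E' where "E' = from_nat_into (insert {} \<E>)"
  have ran: "range E' = insert {} \<E>"
    unfolding E'_def using E(2) by (intro range_from_nat_into) auto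
  have E': "E' n \<in> sets (sigma X \<E>)" for n
  proof -
    have "E' n \<in> insert {} \<E>"
      using ran by auto
    then show ?thesis
      using EX by (auto intro: sigma_sets.Empty)
  qed
  define h where "h x n = (indicator (E' n) x :: real)" for x n
  have h_meas: "h \<in> borel_measurable (sigma X \<E>)"
    by (intro measurable_coordinatewise_then_product) (use E' in \<open>simp add: h_def\<close>)
  have h_inj: "inj_on h X"
  proof (rule inj_onI, rule ccontr)
    fix x y assume xy: "x \<in> X" "y \<in> X" "h x = h y" "x \<noteq> y"
    then obtain S where "S \<in> \<E>" "(x \<in> S) \<noteq> (y \<in> S)"
      using E(3) unfolding separates_points_def by blast
    moreover from \<open>S \<in> \<E>\<close> obtain n where "S = E' n"
      using ran by (metis insertI2 rangeE)
    moreover have "h x n = h y n"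
      using xy by simp
    ultimately show False
      by (auto simp: h_def indicator_def split: if_splits)
  qed
  define C where "C n = f -` E' n \<inter> Omega" for n
  have C: "C n \<in> sets B_Omega" for n
  proof -
    have "E' n \<in> insert {} \<E>"
      using ran by auto
    then show ?thesis
      using E(1) f by (auto simp: C_def induced_sets_def)
  qed
  have B: "f -` A \<inter> Omega \<in> sets B_Omega"
    using A f by (auto simp: induced_sets_def)
  obtain K where K: "compact K" "K \<subseteq> f -` A \<inter> Omega" "measure P (f -` A \<inter> Omega - K) < e"
      "\<And>n. continuous_on K (indicator (C n) :: _ \<Rightarrow> real)"
    using Lusin_B_Omega[where C = C, OF P B C e] by blast
  have "continuous_on K (\<lambda>\<omega>. h (f \<omega>))"
  proof (rule continuous_on_coordinatewise_then_product)
    fix n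
    \<comment> \<open>On \<open>K\<close>, which lies in \<open>Omega\<close>, the
      \<open>n\<close>-th coordinate of \<open>h (f \<omega>)\<close> is the indicator of
      \<open>C n\<close>, the preimage of \<open>E' n\<close>.\<close>
    show "continuous_on K (\<lambda>\<omega>. h (f \<omega>) n)"
      using K(2) by (intro continuous_on_eq[OF K(4)[of n]]) (auto simp: h_def C_def indicator_def)
  qed
  then have "compact ((\<lambda>\<omega>. h (f \<omega>)) ` K)"
    using K(1) by (rule compact_continuous_image)
  then have "h -` ((\<lambda>\<omega>. h (f \<omega>)) ` K) \<inter> X \<in> sets (sigma X \<E>)"
    using measurable_sets[OF h_meas, of "(\<lambda>\<omega>. h (f \<omega>)) ` K"] EX
    by (simp add: borel_compact space_measure_of)
  also have "h -` ((\<lambda>\<omega>. h (f \<omega>)) ` K) \<inter> X = f ` K"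
  proof -
    have "f ` K \<subseteq> X"
      using K(2) fX by auto
    then have "h -` (h ` f ` K) \<inter> X = f ` K"
      using inj_on_image_mem_iff[OF h_inj, of _ "f ` K"] by blast
    then show ?thesis
      by (simp only: image_image)
  qed
  finally have G: "f ` K \<in> sigma_sets X \<E>"
    using EX by simp
  have "K \<in> sets B_Omega"
    using K(1,2) by (intro borel_imp_B_Omega borel_compact) auto
  \<comment> \<open>The preimage of the image of \<open>K\<close> may be larger than
    \<open>K\<close>, which only shrinks the error.\<close>
  then have "measure P (f -` (A - f ` K) \<inter> Omega) \<le> measure P (f -` A \<inter> Omega - K)"
    using B P(2) by (intro finite_measure_mono) auto
  with G K show thesis
    by (intro that[of "f ` K"]) auto
qed

lemma (in quasi_universal_space) sigma_sets_subset_induced: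
  assumes "\<E> \<subseteq> induced_sets X XO"
  shows "sigma_sets X \<E> \<subseteq> induced_sets X XO"
  using sets.sigma_sets_subset[of \<E> "induced_algebra X XO"] assms
  by (simp add: space_induced_algebra sets_induced_algebra)

text \<open>Approximations with error below \<open>1 / Suc n\<close> are united over all
  \<open>n\<close>. The union leaves a remainder contained in every earlier one, and countable
  unions stay in \<open>sigma_sets X \<E>\<close>.\<close>

lemma (in quasi_universal_space) inner_approximation_null:
  assumes E: "\<E> \<subseteq> induced_sets X XO" "countable \<E>" "separates_points \<E> X"
    and A: "A \<in> induced_sets X XO" and f: "f \<in> XO"
    and P: "prob_space P" "sets P = sets B_Omega"
  obtains G where "G \<in> sigma_sets X \<E>" "G \<subseteq> A" "measure P (f -` (A - G) \<inter> Omega) = 0"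
proof -
  interpret prob_space P by (rule P(1))
  have "\<exists>G. G \<in> sigma_sets X \<E> \<and> G \<subseteq> A \<and> measure P (f -` (A - G) \<inter> Omega) < 1 / Suc n" for n
    by (rule inner_approximation[OF E A f P, of "1 / Suc n"]) auto
  then obtain G where G: "\<And>n. G n \<in> sigma_sets X \<E>" "\<And>n. G n \<subseteq> A"
      "\<And>n. measure P (f -` (A - G n) \<inter> Omega) < 1 / Suc n"
    by metis
  have "measure P (f -` (A - (\<Union>n. G n)) \<inter> Omega) \<le> 1 / Suc n" for n
  proof -
    have "G n \<in> induced_sets X XO"
      using G(1) sigma_sets_subset_induced[OF E(1)] by auto
    then have "A - G n \<in> induced_sets X XO"
      using A sets.Diff[of A "induced_algebra X XO" "G n"] by (simp add: sets_induced_algebra)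
    then have "f -` (A - G n) \<inter> Omega \<in> sets P"
      using f P(2) by (auto simp: induced_sets_def)
    then have "measure P (f -` (A - (\<Union>n. G n)) \<inter> Omega) \<le> measure P (f -` (A - G n) \<inter> Omega)"
      by (intro finite_measure_mono) auto
    with G(3)[of n] show ?thesis by simp
  qed
  then have "measure P (f -` (A - (\<Union>n. G n)) \<inter> Omega) \<le> 0"
    by (intro LIMSEQ_le_const[OF lim_1_over_n[where 'a = real, THEN LIMSEQ_Suc]]) auto
  then show thesis
    using G by (intro that[of "\<Union>n. G n"]) (auto intro: sigma_sets.Union simp: order.antisym)
qed

section \<open>Push-forward measures restricted to the generated \<sigma>-algebra\<close>

lemma (in quasi_universal_space) measurable_induced_algebra:
  assumes "f \<in> XO" "sets P = sets B_Omega"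
  shows "f \<in> P \<rightarrow>\<^sub>M induced_algebra X XO"
proof -
  have "f \<in> Omega \<rightarrow> X"
    using assms(1) maps by (auto simp: PiE_def)
  moreover have "space P = Omega"
    using sets_eq_imp_space_eq[OF assms(2)] by (simp add: space_B_Omega)
  ultimately show ?thesis
    using assms
    by (auto intro!: measurableI simp: space_induced_algebra sets_induced_algebra induced_sets_def)
qed

lemma (in quasi_universal_space) subalgebra_induced_algebra:
  assumes "\<E> \<subseteq> induced_sets X XO"
  shows "subalgebra (distr P (induced_algebra X XO) f) (sigma X \<E>)"
proof -
  have "\<E> \<subseteq> Pow X"
    using assms by (auto simp: induced_sets_def)
  then show ?thesis
    using sigma_sets_subset_induced[OF assms]
    by (auto simp: subalgebra_def space_induced_algebra sets_induced_algebra space_measure_of)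
qed

text \<open>Both inclusions translate through this between null sets on \<open>X\<close> and on
  \<open>Omega\<close>: one builds the null set of a completion, the other pulls it back.\<close>

lemma (in quasi_universal_space) null_sets_restr_distr_iff:
  assumes E: "\<E> \<subseteq> induced_sets X XO" and f: "f \<in> XO" and P: "sets P = sets B_Omega"
  shows "N \<in> null_sets (restr_to_subalg (distr P (induced_algebra X XO) f) (sigma X \<E>)) \<longleftrightarrow>
    N \<in> sigma_sets X \<E> \<and> f -` N \<inter> Omega \<in> null_sets P"
proof -
  have EX: "\<E> \<subseteq> Pow X"
    using E by (auto simp: induced_sets_def)
  have "space P = Omega"
    using sets_eq_imp_space_eq[OF P] by (simp add: space_B_Omega)
  then show ?thesis
    using EX measurable_induced_algebra[OF f P] sigma_sets_subset_induced[OF E]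
    by (auto simp: null_sets_restr_to_subalg[OF subalgebra_induced_algebra[OF E]]
        null_sets_distr_iff sets_induced_algebra)
qed

section \<open>Induced sets lie in every completion\<close>

text \<open>Inner approximations \<open>G\<close> of \<open>A\<close> and \<open>H\<close> of
  \<open>X - A\<close> trap \<open>A\<close> between \<open>G\<close> and \<open>X - H\<close>, two
  members of \<open>sigma_sets X \<E>\<close> that differ by a null set.\<close>

lemma (in quasi_universal_space) induced_sets_subset_completed_sets:
  assumes E: "\<E> \<subseteq> induced_sets X XO" "countable \<E>" "separates_points \<E> X"
  shows "induced_sets X XO \<subseteq> completed_sets X \<E> (push_forward_measures X XO)"
proof -
  have EX: "\<E> \<subseteq> Pow X"
    using E(1) by (auto simp: induced_sets_def)
  have "A \<in> sets (completion (restr_to_subalg (distr P (induced_algebra X XO) f) (sigma X \<E>)))"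
    if A: "A \<in> induced_sets X XO" and f: "f \<in> XO" and P: "prob_space P" "sets P = sets B_Omega"
    for A f P
  proof -
    let ?R = "restr_to_subalg (distr P (induced_algebra X XO) f) (sigma X \<E>)"
    interpret prob_space P by (rule P(1))
    have AX: "A \<subseteq> X"
      using A by (auto simp: induced_sets_def)
    have cA: "X - A \<in> induced_sets X XO"
      using A sets.compl_sets[of A "induced_algebra X XO"]
      by (simp add: sets_induced_algebra space_induced_algebra)
    obtain G where G: "G \<in> sigma_sets X \<E>" "G \<subseteq> A" "measure P (f -` (A - G) \<inter> Omega) = 0"
      using inner_approximation_null[OF E A f P] .
    obtain H where H: "H \<in> sigma_sets X \<E>" "H \<subseteq> X - A"
        "measure P (f -` (X - A - H) \<inter> Omega) = 0"
      using inner_approximation_null[OF E cA f P] .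
    have Ind: "f -` (S - T) \<inter> Omega \<in> sets P"
      if "S \<in> induced_sets X XO" "T \<in> sigma_sets X \<E>" for S T
      using that f P(2) sigma_sets_subset_induced[OF E(1)]
        sets.Diff[of S "induced_algebra X XO" T]
      by (auto simp: sets_induced_algebra induced_sets_def)
    have "f -` (A - G) \<inter> Omega \<in> null_sets P" "f -` (X - A - H) \<inter> Omega \<in> null_sets P"
      using G H Ind[OF A G(1)] Ind[OF cA H(1)] by (auto simp: null_sets_def emeasure_eq_measure)
    then have "(f -` (A - G) \<inter> Omega) \<union> (f -` (X - A - H) \<inter> Omega) \<in> null_sets P"
      by (rule null_sets.Un)
    \<comment> \<open>The gap \<open>X - H - G\<close> splits into the two remainders
      \<open>A - G\<close> and \<open>X - A - H\<close>. These need not lie in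
      \<open>sigma_sets X \<E>\<close>, but the gap does, so it serves as the null cover of
      \<open>A - G\<close>.\<close>
    moreover have "f -` (X - H - G) \<inter> Omega =
        (f -` (A - G) \<inter> Omega) \<union> (f -` (X - A - H) \<inter> Omega)"
      using G(2) H(2) AX by auto
    moreover have "X - H - G \<in> sigma_sets X \<E>"
      using sets.Diff[of "X - H" "sigma X \<E>" G] G(1) H(1) EX
      by (simp add: sigma_sets.Compl)
    ultimately have "X - H - G \<in> null_sets ?R"
      by (simp add: null_sets_restr_distr_iff[OF E(1) f P(2)])
    then show ?thesis
      using G H AX EX
      by (intro sets_completionI[of A G "A - G" "X - H - G"])
        (auto simp: sets_restr_to_subalg[OF subalgebra_induced_algebra[OF E(1)]])
  qed
  then show ?thesis
    by (auto simp: completed_sets_def push_forward_measures_def induced_sets_def)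
qed

section \<open>The converse inclusion\<close>

text \<open>Universal measurability is tested against Borel measures, whereas push-forwards start
  from measures on \<open>B_Omega\<close>. Since \<open>B_Omega\<close> is contained in the
  completion of every Borel probability measure \<open>\<mu>\<close>, restricting that completion
  bridges the two.\<close>

lemma B_Omega_extension:
  assumes "prob_space \<mu>" "sets \<mu> = sets (restrict_space borel Omega)"
  obtains P where "prob_space P" "sets P = sets B_Omega"
    "\<And>A. A \<in> sets B_Omega \<Longrightarrow> emeasure P A = emeasure (completion \<mu>) A"
proof -
  have sp: "space \<mu> = Omega"
    using sets_eq_imp_space_eq[OF assms(2)] by (simp add: space_restrict_space)
  have sub: "subalgebra (completion \<mu>) B_Omega"
    using assms
    by (auto simp: subalgebra_def sp space_B_Omega sets_B_Omega universally_measurable_sets_def)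
  show thesis
    by (rule that[of "restr_to_subalg (completion \<mu>) B_Omega"])
      (auto simp: sets_restr_to_subalg[OF sub] emeasure_restr_to_subalg[OF sub]
        intro!: prob_space_restr_to_subalg[OF sub] prob_space.prob_space_completion assms(1))
qed

text \<open>For each Borel \<open>\<mu>\<close>, membership of \<open>A\<close> in the completion
  for the push-forward of the extended measure decomposes \<open>A\<close> into
  \<open>S \<union> N\<close>. The preimage of this decomposition shows that the preimage of
  \<open>A\<close> is measurable for the completion of \<open>\<mu>\<close>.\<close>

lemma (in quasi_universal_space) completed_sets_subset_induced_sets:
  assumes E: "\<E> \<subseteq> induced_sets X XO"
  shows "completed_sets X \<E> (push_forward_measures X XO) \<subseteq> induced_sets X XO"
proof
  fix A assume A: "A \<in> completed_sets X \<E> (push_forward_measures X XO)"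
  have EX: "\<E> \<subseteq> Pow X"
    using E by (auto simp: induced_sets_def)
  have "f -` A \<inter> Omega \<in> sets (completion \<mu>)"
    if f: "f \<in> XO" and \<mu>: "prob_space \<mu>" "sets \<mu> = sets (restrict_space borel Omega)" for f \<mu>
  proof -
    obtain P where P: "prob_space P" "sets P = sets B_Omega"
      "\<And>A. A \<in> sets B_Omega \<Longrightarrow> emeasure P A = emeasure (completion \<mu>) A"
      using B_Omega_extension[OF \<mu>] by metis
    let ?R = "restr_to_subalg (distr P (induced_algebra X XO) f) (sigma X \<E>)"
    have B: "S \<in> sets (completion \<mu>)" if "S \<in> sets B_Omega" for S
      using that \<mu> by (auto simp: sets_B_Omega universally_measurable_sets_def)
    have "A \<in> sets (completion ?R)"
      using A f P(1,2) unfolding completed_sets_def push_forward_measures_def by blast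
    then obtain S N N' where A_eq: "A = S \<union> N" "N \<subseteq> N'" "N' \<in> null_sets ?R" "S \<in> sets ?R"
      by (rule sets_completionE)
    have "S \<in> induced_sets X XO"
      using A_eq(4) EX sigma_sets_subset_induced[OF E]
      by (auto simp: sets_restr_to_subalg[OF subalgebra_induced_algebra[OF E]])
    then have S: "f -` S \<inter> Omega \<in> sets (completion \<mu>)"
      using f B by (auto simp: induced_sets_def)
    have "f -` N' \<inter> Omega \<in> null_sets P"
      using A_eq(3) by (simp add: null_sets_restr_distr_iff[OF E f P(2)])
    then have "f -` N' \<inter> Omega \<in> null_sets (completion \<mu>)"
      using P(2,3) B by (auto simp: null_sets_def)
    \<comment> \<open>\<open>N\<close> is an arbitrary subset of \<open>N'\<close>; its preimage
      becomes measurable because \<open>completion \<mu>\<close> is complete.\<close>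
    then have "f -` N \<inter> Omega \<in> sets (completion \<mu>)"
      using A_eq(2) by (intro completion.complete) auto
    then have "(f -` S \<inter> Omega) \<union> (f -` N \<inter> Omega) \<in> sets (completion \<mu>)"
      using S by auto
    also have "(f -` S \<inter> Omega) \<union> (f -` N \<inter> Omega) = f -` A \<inter> Omega"
      using A_eq(1) by auto
    finally show ?thesis .
  qed
  \<comment> \<open>As \<open>\<mu>\<close> was arbitrary, the preimage is universally measurable;
    \<open>A \<subseteq> X\<close> comes from the factor \<open>Pow X\<close> in
    \<open>completed_sets\<close>.\<close>
  then show "A \<in> induced_sets X XO"
    using A by (auto simp: induced_sets_def completed_sets_def sets_B_Omega
        universally_measurable_sets_def space_restrict_space)
qed

theorem theorem7p10:
  fixes X :: "'a set" and XO :: "((nat \<Rightarrow> real) \<Rightarrow> 'a) set" and \<E> :: "'a set set"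
  assumes "quasi_universal_space X XO"
    and "countably_separated X (induced_sets X XO)"
    and "\<E> \<subseteq> induced_sets X XO"
    and "countable \<E>"
    and "separates_points \<E> X"
  shows "induced_sets X XO = completed_sets X \<E> (push_forward_measures X XO)"
proof -
  interpret quasi_universal_space X XO by (rule assms(1))
  show ?thesis
    using induced_sets_subset_completed_sets completed_sets_subset_induced_sets assms(3-5)
    by (intro equalityI) auto
qed

end
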